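(* Let $\Lambda=\{\lambda_k\}_{k\ge 0}$ be a non-decreasing sequence of positive numbers tending to $\infty$, and let $\{a_k\}_{k\ge1}$ be a sequence of complex numbers. (1) If for every $t$ in a set $A\subseteq\mathbb R$ of positive Lebesgue measure both sequences $$s^1_n(t)=\sum_{k=1}^n a_k\cos kt\quad\text{and}\quad s^2_n(t)=\sum_{k=1}^n a_k\sin kt\qquad(n=0,1,\dots)$$ converge $\Lambda^2$-strongly, then $$\lim_{n\to\infty}\frac1{\lambda_n}\sum_{k=1}^n\lambda_{k-1}|a_k|=0.$$ (2) Consequently, if $f,g\in C$ have Fourier series $\frac12a_0+\sum_{k=1}^\infty a_k\cos kt$ and $\sum_{k=1}^\infty a_k\sin kt$, respectively (with the same coefficients $a_k$, $k\ge1$), and the partial sums of these series converge uniformly $\Lambda^2$-strongly to $f$ and $g$, respectively, then $$\lim_{n\to\infty}\frac1{\lambda_n}\sum_{k=1}^n\lambda_{k-1}|a_k|=0.$$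
   Context: Convention: $\lambda_{-1}=\lambda_{-2}=0$ and, for any sequence $\{s_k\}_{k\ge0}$, $s_{-1}=s_{-2}=0$; empty sums are $0$. A sequence $\{s_k\}_{k\ge 0}$ of complex numbers converges $\Lambda^2$-strongly to $s\in\mathbb C$ if $$\lim_{n\to\infty}\frac1{\lambda_n}\sum_{k=0}^n|\lambda_k(s_k-s)-\lambda_{k-2}(s_{k-2}-s)|=0;$$ it converges $\Lambda^2$-strongly if this holds for some $s\in\mathbb C$ (in (1) the limits may depend on $t$). $C$ is the space of $2\pi$-periodic continuous complex-valued functions on $\mathbb R$ with norm $\|f\|_C=\max_t|f(t)|$. For $f\in C$ with $k$th Fourier partial sum $s_k(f)$ (with $s_0(f)=\frac12 a_0(f)$), the partial sums converge uniformly $\Lambda^2$-strongly to $f$ if $$\lim_{n\to\infty}\left\|\frac1{\lambda_n}\sum_{k=0}^n|\lambda_k(s_k(f)-f)-\lambda_{k-2}(s_{k-2}(f)-f)|\right\|_C=0.$$ *)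

theory Defs
  imports "HOL-Analysis.Analysis"
begin

text \<open>
  The term \<open>s\<^bsub>k-m\<^esub>\<close>, under the convention that members with negative index are \<open>0\<close>.
\<close>
definition shifted :: "nat \<Rightarrow> (nat \<Rightarrow> 'a::zero) \<Rightarrow> nat \<Rightarrow> 'a" where
  "shifted m s k = (if k < m then 0 else s (k - m))"

definition Lambda2_mean :: "(nat \<Rightarrow> real) \<Rightarrow> (nat \<Rightarrow> complex) \<Rightarrow> complex \<Rightarrow> nat \<Rightarrow> real" where
  "Lambda2_mean lam s l n =
     (1 / lam n) *
       (\<Sum>k=0..n. cmod (of_real (lam k) * (s k - l) - of_real (shifted 2 lam k) * (shifted 2 s k - l)))"

definition Lambda2_strongly_tendsto :: "(nat \<Rightarrow> real) \<Rightarrow> (nat \<Rightarrow> complex) \<Rightarrow> complex \<Rightarrow> bool" where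
  "Lambda2_strongly_tendsto lam s l \<longleftrightarrow> (\<lambda>n. Lambda2_mean lam s l n) \<longlonglongrightarrow> 0"

definition Lambda2_strongly_convergent :: "(nat \<Rightarrow> real) \<Rightarrow> (nat \<Rightarrow> complex) \<Rightarrow> bool" where
  "Lambda2_strongly_convergent lam s \<longleftrightarrow> (\<exists>l. Lambda2_strongly_tendsto lam s l)"

definition C_2pi :: "(real \<Rightarrow> 'a::topological_space) set" where
  "C_2pi = {f. continuous_on UNIV f \<and> (\<forall>t. f (t + 2 * pi) = f t)}"

text \<open>
  The supremum is only meaningful for bounded functions; on \<^const>\<open>C_2pi\<close> it is
  an attained maximum (lemma \<open>C_norm_attained\<close>).
\<close>
definition C_norm :: "(real \<Rightarrow> 'a::real_normed_vector) \<Rightarrow> real" where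
  "C_norm f = (SUP t. norm (f t))"

lemma C_norm_attained:
  fixes f :: "real \<Rightarrow> 'a::real_normed_vector"
  assumes "f \<in> C_2pi"
  shows "\<exists>t. C_norm f = norm (f t) \<and> (\<forall>u. norm (f u) \<le> norm (f t))"
proof -
  have cont: "continuous_on UNIV f" and per: "\<And>t. f (t + 2 * pi) = f t"
    using assms by (auto simp: C_2pi_def)
  have "continuous_on {0..2 * pi} (\<lambda>t. norm (f t))"
    using cont by (intro continuous_on_norm) (rule continuous_on_subset, auto)
  then obtain t where t: "t \<in> {0..2 * pi}" "\<forall>u\<in>{0..2 * pi}. norm (f u) \<le> norm (f t)"
    using continuous_attains_sup[of "{0..2 * pi}" "\<lambda>t. norm (f t)"] by auto
  have pern: "f (u + 2 * pi * real n) = f u" for u n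
  proof (induction n)
    case (Suc n)
    show ?case using per[of "u + 2 * pi * real n"] Suc by (simp add: algebra_simps)
  qed simp
  have peri: "f (u + 2 * pi * real_of_int m) = f u" for u m
  proof (cases "m \<ge> 0")
    case True
    then show ?thesis using pern[of u "nat m"] by simp
  next
    case False
    then show ?thesis using pern[of "u + 2 * pi * real_of_int m" "nat (- m)"] by simp
  qed
  have le: "norm (f u) \<le> norm (f t)" for u
  proof -
    define v where "v = u + 2 * pi * real_of_int (- \<lfloor>u / (2 * pi)\<rfloor>)"
    have "u = 2 * pi * (u / (2 * pi))" by simp
    then have "v = 2 * pi * frac (u / (2 * pi))"
      unfolding v_def frac_def by (metis diff_conv_add_uminus distrib_left of_int_minus)
    moreover have "0 \<le> frac (u / (2 * pi))" "frac (u / (2 * pi)) \<le> 1"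
      by (simp_all add: frac_lt_1 less_imp_le)
    ultimately have "v \<in> {0..2 * pi}" by (simp add: mult_left_le)
    moreover have "f v = f u" unfolding v_def by (rule peri)
    ultimately show ?thesis using t by metis
  qed
  then have "C_norm f = norm (f t)"
    unfolding C_norm_def by (intro cSup_eq_maximum) auto
  with le show ?thesis by blast
qed

definition fourier_cos_coeff :: "(real \<Rightarrow> complex) \<Rightarrow> nat \<Rightarrow> complex" where
  "fourier_cos_coeff f k =
     of_real (1 / pi) * integral {-pi..pi} (\<lambda>t. f t * of_real (cos (real k * t)))"

definition fourier_sin_coeff :: "(real \<Rightarrow> complex) \<Rightarrow> nat \<Rightarrow> complex" where
  "fourier_sin_coeff f k =
     of_real (1 / pi) * integral {-pi..pi} (\<lambda>t. f t * of_real (sin (real k * t)))"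

definition fourier_partial_sum :: "(real \<Rightarrow> complex) \<Rightarrow> nat \<Rightarrow> real \<Rightarrow> complex" where
  "fourier_partial_sum f n t =
     (1/2) * fourier_cos_coeff f 0 +
     (\<Sum>k=1..n. fourier_cos_coeff f k * of_real (cos (real k * t)) +
                fourier_sin_coeff f k * of_real (sin (real k * t)))"

text \<open>
  The Fourier series of \<open>f\<close> is
  \<open>c0/2 + (\<Sum>k\<ge>1. c k * cos (k t) + d k * sin (k t))\<close>;
  the values \<open>c 0\<close> and \<open>d 0\<close> are irrelevant.
\<close>
definition has_fourier_series ::
  "(real \<Rightarrow> complex) \<Rightarrow> complex \<Rightarrow> (nat \<Rightarrow> complex) \<Rightarrow> (nat \<Rightarrow> complex) \<Rightarrow> bool" where
  "has_fourier_series f c0 c d \<longleftrightarrow>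
     fourier_cos_coeff f 0 = c0 \<and>
     (\<forall>k\<ge>1. fourier_cos_coeff f k = c k \<and> fourier_sin_coeff f k = d k)"

definition uniformly_Lambda2_strongly :: "(nat \<Rightarrow> real) \<Rightarrow> (real \<Rightarrow> complex) \<Rightarrow> bool" where
  "uniformly_Lambda2_strongly lam f \<longleftrightarrow>
     (\<lambda>n. C_norm (\<lambda>t. Lambda2_mean lam (\<lambda>k. fourier_partial_sum f k t) (f t) n)) \<longlonglongrightarrow> 0"

end

(* Write e_k = s_k - l. Telescoping the differences along each parity class bounds lambda_n |e_n|
   by their sum of absolute values, so Lambda^2-strong convergence forces e_n \<rightarrow> 0. Since
   lambda_{k-2} (s_k - s_{k-2}) differs from the k-th difference by (lambda_k - lambda_{k-2}) e_k,
   it follows that the means of lambda_{k-2} |s_k - s_{k-2}| tend to 0 as well. For the cosine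
   and sine sums, s_k - s_{k-2} is a linear combination of a_k and a_{k-1}, and the 2 x 2
   system has determinant - sin t. So a single t with sin t \<noteq> 0 is enough to control |a_{k-1}|. *)
theory Submission imports Defs begin

section \<open>Consequences of Lambda^2-strong convergence for one scalar sequence\<close>

lemma weighted_means_tendsto_0:
  fixes lam w x :: "nat \<Rightarrow> real"
  assumes pos: "\<And>k. lam k > 0" and lim: "filterlim lam at_top sequentially"
    and w: "\<And>k. w k \<ge> 0" and sum_w: "\<And>n. (\<Sum>k=0..n. w k) \<le> C * lam n"
    and x: "x \<longlonglongrightarrow> 0"
  shows "(\<lambda>n. (1 / lam n) * (\<Sum>k=0..n. w k * \<bar>x k\<bar>)) \<longlonglongrightarrow> 0"
proof (rule LIMSEQ_I)
  fix e :: real assume e: "e > 0"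
  have "0 \<le> C * lam 0" using w[of 0] sum_w[of 0] by simp
  then have C: "C \<ge> 0" using pos[of 0] by (simp add: zero_le_mult_iff)
  \<comment> \<open>Toeplitz-type splitting at \<open>N\<close>: the tail costs at most
    \<open>d * C * lam n\<close>, less than \<open>e / 2 * lam n\<close>, and the head is at most
    the fixed number \<open>M\<close>, which is within \<open>e / 2 * lam n\<close> once
    \<open>lam n\<close> is large. The \<open>+ 1\<close> allows \<open>C = 0\<close>.\<close>
  define d where "d = e / (2 * (C + 1))"
  have d: "d > 0" using e C by (simp add: d_def)
  have dC: "d * C < e / 2" using e C by (simp add: d_def field_simps)
  obtain N where N: "\<And>k. k \<ge> N \<Longrightarrow> \<bar>x k\<bar> < d"
    using LIMSEQ_D[OF x d] by auto
  define M where "M = (\<Sum>k<N. w k * \<bar>x k\<bar>)"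
  obtain N' where N': "\<And>n. n \<ge> N' \<Longrightarrow> 2 * M / e \<le> lam n"
    using lim unfolding filterlim_at_top eventually_sequentially by meson
  show "\<exists>no. \<forall>n\<ge>no. norm ((1 / lam n) * (\<Sum>k=0..n. w k * \<bar>x k\<bar>) - 0) < e"
  proof (intro exI allI impI)
    fix n assume n: "n \<ge> N'"
    have "(\<Sum>k=0..n. w k * \<bar>x k\<bar>)
        \<le> (\<Sum>k=0..n. (if k < N then w k * \<bar>x k\<bar> else 0) + d * w k)"
    proof (rule sum_mono)
      fix k
      show "w k * \<bar>x k\<bar> \<le> (if k < N then w k * \<bar>x k\<bar> else 0) + d * w k"
        using w[of k] d N[of k] by (auto simp: mult.commute[of d] intro!: mult_left_mono)
    qed
    also have "\<dots> = (\<Sum>k\<in>{0..n} \<inter> {..<N}. w k * \<bar>x k\<bar>) + d * (\<Sum>k=0..n. w k)"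
      by (simp add: sum.distrib sum_distrib_left sum.inter_restrict)
    also have "\<dots> \<le> M + d * (C * lam n)"
      unfolding M_def using w d sum_w[of n]
      by (intro add_mono mult_left_mono sum_mono2) auto
    also have "\<dots> < e / 2 * lam n + e / 2 * lam n"
    proof -
      have "M \<le> e / 2 * lam n" using N'[OF n] e by (simp add: field_simps)
      moreover have "d * (C * lam n) < e / 2 * lam n"
        using dC pos[of n] by (simp add: mult.assoc[symmetric] del: times_divide_eq_left)
      ultimately show ?thesis by simp
    qed
    finally have "(\<Sum>k=0..n. w k * \<bar>x k\<bar>) < e * lam n" by simp
    moreover have "0 \<le> (\<Sum>k=0..n. w k * \<bar>x k\<bar>)" using w by (simp add: sum_nonneg)
    ultimately show "norm ((1 / lam n) * (\<Sum>k=0..n. w k * \<bar>x k\<bar>) - 0) < e"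
      using pos[of n] by (simp add: field_simps)
  qed
qed

text \<open>At index 0 or 1 the factor \<open>shifted 2 lam k\<close> vanishes, so the difference is
  the whole term \<open>lam k * (s k - l)\<close>; this is where the telescoping along one parity
  class starts. Division by \<open>lam n\<close> then bounds \<open>cmod (s n - l)\<close> by the
  mean itself.\<close>

lemma Lambda2_strongly_tendsto_imp_tendsto:
  assumes pos: "\<And>k. lam k > 0" and s: "Lambda2_strongly_tendsto lam s l"
  shows "s \<longlonglongrightarrow> l"
proof -
  define D where "D k = of_real (lam k) * (s k - l) - of_real (shifted 2 lam k) * (shifted 2 s k - l)"
    for k
  have telescope: "cmod (of_real (lam n) * (s n - l)) \<le> (\<Sum>k=0..n. cmod (D k))" for n
  proof (induction n rule: less_induct)
    case (less n)
    show ?case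
    proof (cases "n < 2")
      case True
      then have "cmod (of_real (lam n) * (s n - l)) = cmod (D n)"
        by (simp add: D_def shifted_def)
      also have "\<dots> \<le> (\<Sum>k=0..n. cmod (D k))" by (rule member_le_sum) auto
      finally show ?thesis .
    next
      case False
      then obtain m where m: "n = Suc (Suc m)" by (metis less_2_cases_iff not0_implies_Suc One_nat_def)
      have "of_real (lam n) * (s n - l) = D n + of_real (lam m) * (s m - l)"
        by (simp add: D_def shifted_def m)
      then have "cmod (of_real (lam n) * (s n - l)) \<le> cmod (D n) + (\<Sum>k=0..m. cmod (D k))"
        using less.IH[of m] m by (metis add_left_mono less_Suc_eq norm_triangle_le)
      \<comment> \<open>The full sum also contains the index \<open>Suc m\<close> of the other
        parity, which only enlarges it.\<close>
      then show ?thesis using norm_ge_zero[of "D (Suc m)"]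
        unfolding m sum.atLeast0_atMost_Suc by linarith
    qed
  qed
  have "cmod (s n - l) \<le> Lambda2_mean lam s l n" for n
    using telescope[of n] pos[of n]
    unfolding Lambda2_mean_def D_def[symmetric] norm_mult norm_of_real
    by (simp add: pos_le_divide_eq mult.commute)
  with s have "(\<lambda>n. s n - l) \<longlonglongrightarrow> 0"
    unfolding Lambda2_strongly_tendsto_def
    by (rule Lim_null_comparison[OF always_eventually[OF allI], rotated])
  then show ?thesis by (simp add: LIM_zero_iff)
qed

text \<open>The correction terms \<open>w k * cmod (s k - l)\<close> average to 0 because
  \<open>s\<close> tends to \<open>l\<close> and the weights \<open>w k\<close> have total at most
  \<open>2 * lam n\<close>.\<close>

lemma Lambda2_strongly_tendsto_imp_increments:
  assumes mono: "mono lam" and pos: "\<And>k. lam k > 0" and lim: "filterlim lam at_top sequentially"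
    and s: "Lambda2_strongly_tendsto lam s l"
  shows "(\<lambda>n. (1 / lam n) * (\<Sum>k=2..n. lam (k - 2) * cmod (s k - s (k - 2)))) \<longlonglongrightarrow> 0"
proof -
  define w where "w k = lam k - shifted 2 lam k" for k
  have w: "w k \<ge> 0" for k
    using monoD[OF mono, of "k - 2" k] pos[of k] by (simp add: w_def shifted_def)
  \<comment> \<open>Each parity class telescopes to its last member. For \<open>n = 0\<close> there
    is only one class; truncated subtraction would otherwise count \<open>lam 0\<close>
    twice.\<close>
  have "(\<Sum>k=0..n. w k) = lam n + (if n = 0 then 0 else lam (n - 1))" for n
  proof (induction n)
    case (Suc n)
    then show ?case by (cases n) (auto simp: w_def shifted_def)
  qed (simp add: w_def shifted_def)
  then have sum_w: "(\<Sum>k=0..n. w k) \<le> 2 * lam n" for n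
    using monoD[OF mono, of "n - 1" n] pos[of n] pos[of 0] by (simp add: less_imp_le)
  have "(\<lambda>n. cmod (s n - l)) \<longlonglongrightarrow> 0"
    using Lambda2_strongly_tendsto_imp_tendsto[OF pos s] by (simp add: LIM_zero_iff tendsto_norm_zero)
  from weighted_means_tendsto_0[OF pos lim w sum_w this]
  have "(\<lambda>n. Lambda2_mean lam s l n + (1 / lam n) * (\<Sum>k=0..n. w k * cmod (s k - l))) \<longlonglongrightarrow> 0"
    using s unfolding Lambda2_strongly_tendsto_def by (intro tendsto_add_zero) auto
  moreover have "norm ((1 / lam n) * (\<Sum>k=2..n. lam (k - 2) * cmod (s k - s (k - 2))))
      \<le> Lambda2_mean lam s l n + (1 / lam n) * (\<Sum>k=0..n. w k * cmod (s k - l))" for n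
  proof -
    let ?D = "\<lambda>k. of_real (lam k) * (s k - l) - of_real (shifted 2 lam k) * (shifted 2 s k - l)"
    have "lam (k - 2) * cmod (s k - s (k - 2)) \<le> cmod (?D k) + w k * cmod (s k - l)"
      if "k \<ge> 2" for k
    proof -
      have "of_real (lam (k - 2)) * (s k - s (k - 2)) = ?D k - of_real (w k) * (s k - l)"
        using that by (simp add: w_def shifted_def algebra_simps)
      then have "cmod (of_real (lam (k - 2)) * (s k - s (k - 2)))
          \<le> cmod (?D k) + cmod (of_real (w k) * (s k - l))"
        by (simp only: norm_triangle_ineq4)
      then show ?thesis using pos[of "k - 2"] w[of k] by (simp add: norm_mult)
    qed
    then have "(\<Sum>k=2..n. lam (k - 2) * cmod (s k - s (k - 2)))
        \<le> (\<Sum>k=2..n. cmod (?D k) + w k * cmod (s k - l))"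
      by (intro sum_mono) auto
    also have "\<dots> \<le> (\<Sum>k=0..n. cmod (?D k) + w k * cmod (s k - l))"
      using w by (intro sum_mono2) auto
    finally have "(1 / lam n) * (\<Sum>k=2..n. lam (k - 2) * cmod (s k - s (k - 2)))
        \<le> (1 / lam n) * (\<Sum>k=0..n. cmod (?D k) + w k * cmod (s k - l))"
      using pos[of n] by (intro mult_left_mono) auto
    also have "\<dots> = Lambda2_mean lam s l n + (1 / lam n) * (\<Sum>k=0..n. w k * cmod (s k - l))"
      by (simp add: Lambda2_mean_def sum.distrib distrib_left)
    finally show ?thesis
      using pos less_imp_le[OF pos] by (simp add: sum_nonneg)
  qed
  ultimately show ?thesis
    by (rule Lim_null_comparison[OF always_eventually[OF allI], rotated])
qed

section \<open>Coefficient bounds from the cosine and sine sums at one point\<close>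

lemma cos_sin_system_bound:
  fixes a b :: complex and x y :: real
  shows "\<bar>sin (x - y)\<bar> * cmod b
    \<le> cmod (a * of_real (cos x) + b * of_real (cos y)) + cmod (a * of_real (sin x) + b * of_real (sin y))"
    (is "_ \<le> cmod ?X + cmod ?Y")
proof -
  \<comment> \<open>Cramer's rule: this combination eliminates \<open>a\<close>, and the addition
    formula turns the factor of \<open>b\<close> into \<open>sin (x - y)\<close>.\<close>
  have "of_real (sin (x - y)) * b = of_real (sin x) * ?X - of_real (cos x) * ?Y"
    by (simp add: sin_diff algebra_simps)
  then have "cmod (of_real (sin (x - y)) * b)
      \<le> cmod (of_real (sin x) * ?X) + cmod (of_real (cos x) * ?Y)"
    by (simp only: norm_triangle_ineq4)
  also have "\<dots> \<le> cmod ?X + cmod ?Y"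
    unfolding norm_mult norm_of_real
    by (intro add_mono mult_left_le_one_le) (auto simp: abs_sin_le_one abs_cos_le_one)
  finally show ?thesis by (simp add: norm_mult)
qed

text \<open>Consecutive angles always differ by \<open>t\<close>, so one determinant serves every
  index. Two-step increments up to \<open>Suc n\<close> control \<open>a 1\<close> to
  \<open>a n\<close>, already with the right weights; the remaining \<open>a (Suc n)\<close> is
  controlled by the one-step increments \<open>J n\<close>.\<close>

lemma coefficient_means_tendsto_0:
  fixes lam :: "nat \<Rightarrow> real" and a :: "nat \<Rightarrow> complex"
  assumes mono: "mono lam" and pos: "\<And>k. lam k > 0" and lim: "filterlim lam at_top sequentially"
    and t: "sin t \<noteq> 0"
    and c: "Lambda2_strongly_convergent lam (\<lambda>n. \<Sum>k=1..n. a k * of_real (cos (real k * t)))"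
    and s: "Lambda2_strongly_convergent lam (\<lambda>n. \<Sum>k=1..n. a k * of_real (sin (real k * t)))"
  shows "(\<lambda>n. (1 / lam n) * (\<Sum>k=1..n. lam (k - 1) * cmod (a k))) \<longlonglongrightarrow> 0"
proof -
  let ?c = "\<lambda>n. \<Sum>k=1..n. a k * of_real (cos (real k * t))"
  let ?s = "\<lambda>n. \<Sum>k=1..n. a k * of_real (sin (real k * t))"
  obtain lc ls where lc: "Lambda2_strongly_tendsto lam ?c lc" and ls: "Lambda2_strongly_tendsto lam ?s ls"
    using c s unfolding Lambda2_strongly_convergent_def by blast
  note clim = Lambda2_strongly_tendsto_imp_tendsto[OF pos lc]
    and slim = Lambda2_strongly_tendsto_imp_tendsto[OF pos ls]
  define I where "I n = (1 / lam n) * (\<Sum>k=2..n. lam (k - 2) * cmod (?c k - ?c (k - 2)))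
    + (1 / lam n) * (\<Sum>k=2..n. lam (k - 2) * cmod (?s k - ?s (k - 2)))" for n
  have I: "I \<longlonglongrightarrow> 0"
    unfolding I_def
    using Lambda2_strongly_tendsto_imp_increments[OF mono pos lim lc]
      Lambda2_strongly_tendsto_imp_increments[OF mono pos lim ls]
    by (rule tendsto_add_zero)
  define J where "J n = cmod (?c (Suc n) - ?c n) + cmod (?s (Suc n) - ?s n)" for n
  have J: "J \<longlonglongrightarrow> 0"
    unfolding J_def
    using tendsto_diff[OF LIMSEQ_Suc[OF clim] clim] tendsto_diff[OF LIMSEQ_Suc[OF slim] slim]
    by (intro tendsto_add_zero tendsto_norm_zero) simp_all
  have last: "cmod (a (Suc n)) \<le> J n" for n
  proof -
    let ?x = "real (Suc n) * t"
    \<comment> \<open>Follows from cos^2 + sin^2 = 1, as the square of a number in [0, 1] does not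
      exceed it.\<close>
    have "1 \<le> \<bar>cos ?x\<bar> + \<bar>sin ?x\<bar>" 
      using mult_left_le[of "\<bar>sin ?x\<bar>" "\<bar>sin ?x\<bar>"] mult_left_le[of "\<bar>cos ?x\<bar>" "\<bar>cos ?x\<bar>"]
        sin_cos_squared_add[of ?x] abs_sin_le_one[of ?x] abs_cos_le_one[of ?x]
      unfolding power2_eq_square abs_mult_self_eq by linarith
    then have "cmod (a (Suc n)) * 1 \<le> cmod (a (Suc n)) * (\<bar>cos ?x\<bar> + \<bar>sin ?x\<bar>)"
      by (intro mult_left_mono) auto
    then show ?thesis
      by (simp add: J_def norm_mult distrib_left del: of_nat_Suc)
  qed
  have step: "\<bar>sin t\<bar> * cmod (a (Suc m))
      \<le> cmod (?c (Suc (Suc m)) - ?c m) + cmod (?s (Suc (Suc m)) - ?s m)" for m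
    \<comment> \<open>Here \<open>a (Suc m)\<close> takes the role of \<open>b\<close>, the unknown
      that survives, and the angles differ by exactly \<open>t\<close>.\<close>
    using cos_sin_system_bound[of "real (Suc (Suc m)) * t" "real (Suc m) * t" "a (Suc m)" "a (Suc (Suc m))"]
    by (simp add: algebra_simps)
  have bound: "norm ((1 / lam (Suc n)) * (\<Sum>k=1..Suc n. lam (k - 1) * cmod (a k)))
      \<le> I (Suc n) / \<bar>sin t\<bar> + J n" for n
  proof -
    have split: "(\<Sum>k=1..Suc n. lam (k - 1) * cmod (a k))
        = (\<Sum>m<n. lam m * cmod (a (Suc m))) + lam n * cmod (a (Suc n))"
      by (simp add: sum.atLeast1_atMost_eq del: sum.cl_ivl_Suc)
    \<comment> \<open>Reindexing by \<open>k = m + 2\<close>; the two arguments of \<open>g\<close>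
      let the truncated \<open>k - 2\<close> disappear on the right.\<close>
    have shift: "(\<Sum>k=2..Suc n. g (k - 2) k) = (\<Sum>m<n. g m (Suc (Suc m)))"
      for g :: "nat \<Rightarrow> nat \<Rightarrow> real"
      by (induction n) auto
    have "\<bar>sin t\<bar> * (\<Sum>m<n. lam m * cmod (a (Suc m)))
        = (\<Sum>m<n. lam m * (\<bar>sin t\<bar> * cmod (a (Suc m))))"
      by (simp add: sum_distrib_left mult_ac)
    also have "\<dots> \<le> (\<Sum>m<n. lam m * (cmod (?c (Suc (Suc m)) - ?c m) + cmod (?s (Suc (Suc m)) - ?s m)))"
      using less_imp_le[OF pos] by (intro sum_mono mult_left_mono step) auto
    also have "\<dots> = (\<Sum>k=2..Suc n. lam (k - 2) * cmod (?c k - ?c (k - 2)))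
        + (\<Sum>k=2..Suc n. lam (k - 2) * cmod (?s k - ?s (k - 2)))"
      unfolding shift[of "\<lambda>m k. lam m * cmod (?c k - ?c m)"] shift[of "\<lambda>m k. lam m * cmod (?s k - ?s m)"]
      by (simp only: sum.distrib distrib_left)
    also have "\<dots> = lam (Suc n) * I (Suc n)"
      using pos[of "Suc n"] by (simp add: I_def field_simps del: sum.cl_ivl_Suc)
    finally have "(\<Sum>m<n. lam m * cmod (a (Suc m))) \<le> lam (Suc n) * (I (Suc n) / \<bar>sin t\<bar>)"
      using t by (simp add: field_simps)
    moreover have "lam n * cmod (a (Suc n)) \<le> lam (Suc n) * J n"
      using last[of n] monoD[OF mono, of n "Suc n"] less_imp_le[OF pos]
      by (intro mult_mono) auto
    ultimately have "(\<Sum>k=1..Suc n. lam (k - 1) * cmod (a k)) \<le> lam (Suc n) * (I (Suc n) / \<bar>sin t\<bar> + J n)"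
      unfolding split distrib_left by (rule add_mono)
    then have "(1 / lam (Suc n)) * (\<Sum>k=1..Suc n. lam (k - 1) * cmod (a k)) \<le> I (Suc n) / \<bar>sin t\<bar> + J n"
      using pos[of "Suc n"] by (simp add: field_simps del: sum.cl_ivl_Suc)
    moreover have "0 \<le> (1 / lam (Suc n)) * (\<Sum>k=1..Suc n. lam (k - 1) * cmod (a k))"
      using less_imp_le[OF pos] by (intro mult_nonneg_nonneg sum_nonneg) auto
    ultimately show ?thesis by (simp del: sum.cl_ivl_Suc)
  qed
  have "(\<lambda>n. I (Suc n) / \<bar>sin t\<bar> + J n) \<longlonglongrightarrow> 0"
    using tendsto_divide[OF LIMSEQ_Suc[OF I] tendsto_const[of "\<bar>sin t\<bar>"]] t J
    by (intro tendsto_add_zero) auto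
  then have "(\<lambda>n. (1 / lam (Suc n)) * (\<Sum>k=1..Suc n. lam (k - 1) * cmod (a k))) \<longlonglongrightarrow> 0"
    using bound by (rule Lim_null_comparison[OF always_eventually, rotated, OF _ allI])
  then show ?thesis by (rule LIMSEQ_imp_Suc)
qed

text \<open>The zeros of the sine are the integer multiples of pi, a countable and hence null
  set.\<close>

lemma ex_sin_nonzero_if_emeasure_pos:
  assumes "emeasure lebesgue A > 0"
  shows "\<exists>t\<in>A. sin t \<noteq> (0::real)"
proof (rule ccontr)
  assume "\<not> ?thesis"
  then have "A \<subseteq> range (\<lambda>i::int. of_int i * pi)"
    by (auto simp: sin_zero_iff_int2)
  then have "countable A" by (rule countable_subset) auto
  then have "A \<in> null_sets lebesgue"
    by (intro null_sets_completionI countable_imp_null_set_lborel)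
  with assms show False by (auto simp: null_sets_def)
qed

section \<open>From uniform to pointwise Lambda^2-strong convergence of Fourier sums\<close>

lemma fourier_partial_sum_in_C_2pi: "fourier_partial_sum f n \<in> C_2pi"
proof -
  have "cos (real k * (t + 2 * pi)) = cos (real k * t)"
    and "sin (real k * (t + 2 * pi)) = sin (real k * t)" for k t
    using cos.plus_of_nat[of "real k * t" k] sin.plus_of_nat[of "real k * t" k]
    by (simp_all add: distrib_left)
  then show ?thesis
    unfolding C_2pi_def fourier_partial_sum_def by (auto intro!: continuous_intros)
qed

text \<open>Membership in \<open>C_2pi\<close> makes \<open>C_norm\<close> of the mean an attained
  maximum, so that it dominates the mean at each single \<open>t\<close>.\<close>

lemma Lambda2_mean_fourier_in_C_2pi:
  assumes "f \<in> C_2pi"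
  shows "(\<lambda>t. Lambda2_mean lam (\<lambda>k. fourier_partial_sum f k t) (f t) n) \<in> C_2pi"
proof -
  have f: "continuous_on UNIV f" "\<And>t. f (t + 2 * pi) = f t"
    using assms by (auto simp: C_2pi_def)
  have S: "continuous_on UNIV (fourier_partial_sum f k)"
    "\<And>t. fourier_partial_sum f k (t + 2 * pi) = fourier_partial_sum f k t" for k
    using fourier_partial_sum_in_C_2pi[of f k] by (auto simp: C_2pi_def)
  have shifted: "continuous_on UNIV (\<lambda>t. shifted 2 (\<lambda>k. fourier_partial_sum f k t) k)" for k
    using S(1) by (cases "k < 2") (auto simp: shifted_def)
  have "continuous_on UNIV (\<lambda>t. Lambda2_mean lam (\<lambda>k. fourier_partial_sum f k t) (f t) n)"
    unfolding Lambda2_mean_def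
    by (intro continuous_on_mult[OF continuous_on_const] continuous_on_sum continuous_on_norm
        continuous_on_diff f(1) S(1) shifted)
  then show ?thesis
    by (simp add: C_2pi_def f(2) S(2))
qed

lemma uniformly_Lambda2_strongly_imp_tendsto:
  assumes f: "f \<in> C_2pi" and u: "uniformly_Lambda2_strongly lam f"
  shows "Lambda2_strongly_tendsto lam (\<lambda>k. fourier_partial_sum f k t) (f t)"
proof -
  have "norm (Lambda2_mean lam (\<lambda>k. fourier_partial_sum f k t) (f t) n)
      \<le> C_norm (\<lambda>t. Lambda2_mean lam (\<lambda>k. fourier_partial_sum f k t) (f t) n)" for n
    using C_norm_attained[OF Lambda2_mean_fourier_in_C_2pi[OF f, of lam n]] by metis
  from this u show ?thesis
    unfolding uniformly_Lambda2_strongly_def Lambda2_strongly_tendsto_def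
    by (rule Lim_null_comparison[OF always_eventually[OF allI]])
qed

text \<open>Serves to strip the constant term \<open>a0 / 2\<close> from the Fourier sums. For
  \<open>k < 2\<close> the shifted sequence is 0 and does not contain \<open>c\<close>, but there
  its factor \<open>shifted 2 lam k\<close> is 0 too.\<close>

lemma Lambda2_strongly_tendsto_add_const:
  "Lambda2_strongly_tendsto lam (\<lambda>n. c + s n) l \<longleftrightarrow> Lambda2_strongly_tendsto lam s (l - c)"
proof -
  have "of_real (shifted 2 lam k) * (shifted 2 (\<lambda>n. c + s n) k - l)
      = of_real (shifted 2 lam k) * (shifted 2 s k - (l - c))" for k
    by (simp add: shifted_def algebra_simps)
  then show ?thesis
    unfolding Lambda2_strongly_tendsto_def Lambda2_mean_def by (simp add: algebra_simps)
qed

theorem theorem8: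
  fixes lam :: "nat \<Rightarrow> real" and a :: "nat \<Rightarrow> complex"
  assumes "mono lam" and "\<And>k. lam k > 0" and "filterlim lam at_top sequentially"
  shows
    "(\<forall>A. A \<in> sets lebesgue \<and> emeasure lebesgue A > 0 \<and>
        (\<forall>t\<in>A.
           Lambda2_strongly_convergent lam (\<lambda>n. \<Sum>k=1..n. a k * of_real (cos (real k * t))) \<and>
           Lambda2_strongly_convergent lam (\<lambda>n. \<Sum>k=1..n. a k * of_real (sin (real k * t))))
        \<longrightarrow> (\<lambda>n. (1 / lam n) * (\<Sum>k=1..n. lam (k - 1) * cmod (a k))) \<longlonglongrightarrow> 0)
     \<and>
     (\<forall>a0 f g. f \<in> C_2pi \<and> g \<in> C_2pi \<and>
        has_fourier_series f a0 a (\<lambda>_. 0) \<and> has_fourier_series g 0 (\<lambda>_. 0) a \<and>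
        uniformly_Lambda2_strongly lam f \<and> uniformly_Lambda2_strongly lam g
        \<longrightarrow> (\<lambda>n. (1 / lam n) * (\<Sum>k=1..n. lam (k - 1) * cmod (a k))) \<longlonglongrightarrow> 0)"
proof (intro conjI allI impI; elim conjE)
  fix A :: "real set"
  assume "emeasure lebesgue A > 0"
    and A: "\<forall>t\<in>A.
      Lambda2_strongly_convergent lam (\<lambda>n. \<Sum>k=1..n. a k * of_real (cos (real k * t))) \<and>
      Lambda2_strongly_convergent lam (\<lambda>n. \<Sum>k=1..n. a k * of_real (sin (real k * t)))"
  then obtain t where "t \<in> A" "sin t \<noteq> 0" using ex_sin_nonzero_if_emeasure_pos by blast
  with A show "(\<lambda>n. (1 / lam n) * (\<Sum>k=1..n. lam (k - 1) * cmod (a k))) \<longlonglongrightarrow> 0"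
    by (intro coefficient_means_tendsto_0[OF assms, of t]) auto
next
  fix a0 f g
  assume f: "f \<in> C_2pi" "has_fourier_series f a0 a (\<lambda>_. 0)" "uniformly_Lambda2_strongly lam f"
    and g: "g \<in> C_2pi" "has_fourier_series g 0 (\<lambda>_. 0) a" "uniformly_Lambda2_strongly lam g"
  \<comment> \<open>Uniform convergence gives convergence at every point; this one has
    \<open>sin ?t = 1\<close>.\<close>
  let ?t = "pi / 2"
  have "fourier_partial_sum f n ?t = a0 / 2 + (\<Sum>k=1..n. a k * of_real (cos (real k * ?t)))" for n
    using f(2) by (simp add: fourier_partial_sum_def has_fourier_series_def)
  then have "Lambda2_strongly_convergent lam (\<lambda>n. \<Sum>k=1..n. a k * of_real (cos (real k * ?t)))"
    using uniformly_Lambda2_strongly_imp_tendsto[OF f(1,3), of ?t]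
    unfolding Lambda2_strongly_convergent_def by (auto simp only: Lambda2_strongly_tendsto_add_const)
  moreover have "fourier_partial_sum g n ?t = (\<Sum>k=1..n. a k * of_real (sin (real k * ?t)))" for n
    using g(2) by (simp add: fourier_partial_sum_def has_fourier_series_def)
  then have "Lambda2_strongly_convergent lam (\<lambda>n. \<Sum>k=1..n. a k * of_real (sin (real k * ?t)))"
    using uniformly_Lambda2_strongly_imp_tendsto[OF g(1,3), of ?t]
    unfolding Lambda2_strongly_convergent_def by auto
  ultimately show "(\<lambda>n. (1 / lam n) * (\<Sum>k=1..n. lam (k - 1) * cmod (a k))) \<longlonglongrightarrow> 0"
    by (intro coefficient_means_tendsto_0[OF assms, of ?t]) auto
qed

end
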